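(* There exists an absolute constant $C>1$ such that the following holds. Let $\varepsilon=\varepsilon(n)\in(0,1)$ and $p=p(n)\in(0,1)$, and for every sufficiently large $n$ let $G=G_n$ be a weakly $(p,A\sqrt{np})$-bijumbled graph of order $n$, where $\varepsilon^3np^2\ge A^2C$ and $p<1-15\sqrt{\varepsilon}$. If $D$ is chosen uniformly at random among the $2^{e(G)}$ possible orientations of $G$, then asymptotically almost surely (with probability tending to $1$ as $n\to\infty$) $D$ has a Seymour vertex.
   Context: A graph $G$ of order $n$ is weakly $(p,\alpha)$-bijumbled if for all $U,W\subset V(G)$ with $U\cap W=\emptyset$ and $1\le |U|\le |W|\le np|U|$ we have $\bigl|e(U,W)-p|U||W|\bigr|\le \alpha\sqrt{|U||W|}$, where $e(U,W)$ is the number of edges with one vertex in each of $U$ and $W$. Throughout, $A>0$ denotes a fixed absolute constant with $A\le \mathrm{e}^2\sqrt{6}$ such that, for every $p\colon\mathbb{N}\to(0,1]$, the binomial random graph $G(n,p)$ (vertex set $\{1,\dots,n\}$, each pair an edge independently with probability $p$) is weakly $(p,A\sqrt{np})$-bijumbled with probability tending to $1$ as $n\to\infty$; such a constant is known to exist. $e(G)$ is the number of edges of $G$. An orientation of a simple graph $G$ is a digraph obtained by assigning a direction to each edge of $G$. For a vertex $u$ of an oriented graph and $i\in\mathbb{N}$, $N^i(u)$ is the set of vertices $v$ for which a shortest directed path from $u$ to $v$ has precisely $i$ arcs. A Seymour vertex is a vertex $u$ with $|N^2(u)|\ge |N^1(u)|$. *)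

theory Defs
  imports
    "HOL-Probability.Probability"
    "HOL-Library.Ramsey"
    "Graph_Theory.Pair_Digraph"
begin

(* Undirected graphs are given by a vertex set V and a set E of two-element subsets of V;
   nsets V 2 is the set of all two-element subsets of V.  Digraphs are those of
   Graph_Theory.Pair_Digraph, with arcs represented as ordered pairs. *)

definition simple_graph :: "'a set \<Rightarrow> 'a set set \<Rightarrow> bool" where
  "simple_graph V E \<longleftrightarrow> finite V \<and> E \<subseteq> nsets V 2"

definition edges_between :: "'a set set \<Rightarrow> 'a set \<Rightarrow> 'a set \<Rightarrow> nat" where
  "edges_between E U W = card {e \<in> E. \<exists>u\<in>U. \<exists>w\<in>W. e = {u, w}}"

definition weakly_bijumbled :: "'a set \<Rightarrow> 'a set set \<Rightarrow> real \<Rightarrow> real \<Rightarrow> bool" where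
  "weakly_bijumbled V E p \<alpha> \<longleftrightarrow>
     (\<forall>U W. U \<subseteq> V \<and> W \<subseteq> V \<and> U \<inter> W = {} \<and> 1 \<le> card U \<and> card U \<le> card W \<and>
        real (card W) \<le> real (card V) * p * real (card U) \<longrightarrow>
        \<bar>real (edges_between E U W) - p * real (card U) * real (card W)\<bar>
          \<le> \<alpha> * sqrt (real (card U) * real (card W)))"

(* The edge set of the binomial random graph G(n, p) on the vertex set {1..n}. *)
definition binomial_random_graph :: "nat \<Rightarrow> real \<Rightarrow> nat set set pmf" where
  "binomial_random_graph n p =
     map_pmf (\<lambda>x. {e \<in> nsets {1..n} 2. x e})
       (Pi_pmf (nsets {1..n} 2) False (\<lambda>_. bernoulli_pmf p))"

definition orientations :: "'a set \<Rightarrow> 'a set set \<Rightarrow> 'a pair_pre_digraph set" where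
  "orientations V E =
     {D. pverts D = V \<and>
         (\<forall>u v. (u, v) \<in> parcs D \<longrightarrow> {u, v} \<in> E) \<and>
         (\<forall>u v. {u, v} \<in> E \<longrightarrow> ((u, v) \<in> parcs D) \<noteq> ((v, u) \<in> parcs D))}"

(* Uniform over a finite nonempty set whenever simple_graph V E holds. *)
definition random_orientation :: "'a set \<Rightarrow> 'a set set \<Rightarrow> 'a pair_pre_digraph pmf" where
  "random_orientation V E = pmf_of_set (orientations V E)"

definition nbhd :: "'a pair_pre_digraph \<Rightarrow> nat \<Rightarrow> 'a \<Rightarrow> 'a set" where
  "nbhd D i u =
     {v. \<exists>P. pre_digraph.apath (with_proj D) u P v \<and> length P = i \<and>
           (\<forall>Q. pre_digraph.apath (with_proj D) u Q v \<longrightarrow> length P \<le> length Q)}"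

definition seymour_vertex :: "'a pair_pre_digraph \<Rightarrow> 'a \<Rightarrow> bool" where
  "seymour_vertex D u \<longleftrightarrow>
     u \<in> pverts D \<and> card (nbhd D 2 u) \<ge> card (nbhd D 1 u)"

end

theory Submission
  imports Defs
begin

text \<open>
  All randomness is in one union bound. For fixed \<open>U\<close>, \<open>W\<close> with at least \<open>3 n\<close> edges between them, no arc
  leads from \<open>U\<close> to \<open>W\<close> with probability at most \<open>8\<^sup>-\<^sup>n\<close>; as there are \<open>4\<^sup>n\<close> pairs, with
  probability at least \<open>1 - 2\<^sup>-\<^sup>n\<close> every such pair has an arc from \<open>U\<close> to \<open>W\<close>.
  What remains is deterministic. Put \<open>s = sqrt \<epsilon>\<close> and \<open>c = 24 + 16 A\<^sup>2\<close>. By bijumbledness, pairs with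
  \<open>|U| \<ge> c/p\<close>, \<open>|W| \<ge> n/4\<close> or with \<open>|U| \<ge> np/(4c)\<close>, \<open>|W| \<ge> s n\<close> have \<open>3 n\<close> edges.
  The first kind shows that about \<open>c/p\<close> vertices together dominate more than half of the graph, so
  only about \<open>c/p\<close> vertices can have outdegree below \<open>np/(4c)\<close>. The second kind shows that a vertex \<open>u\<close> of larger
  outdegree \<open>d\<close> reaches all but \<open>s n\<close> vertices in at most two steps, so \<open>2 d > n - 1 - s n\<close> unless
  \<open>u\<close> is a Seymour vertex. Without a Seymour vertex, summing over \<open>u\<close> would give more edges than
  bijumbledness and \<open>p < 1 - 15 s\<close> allow.
\<close>

section \<open>Simple graphs and the set of their orientations\<close>

lemma finite_graph_edges:
  assumes "simple_graph V E"
  shows "finite E"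
  using assms unfolding simple_graph_def by (metis finite_imp_finite_nsets finite_subset)

lemma edge_in_vertices:
  assumes "simple_graph V E" "{u, v} \<in> E"
  shows "u \<in> V" "v \<in> V" "u \<noteq> v"
  using assms unfolding simple_graph_def nsets_def by (auto simp: card_insert_if split: if_splits)

lemma edge_doubleton:
  assumes "simple_graph V E" "e \<in> E"
  obtains u v where "e = {u, v}" "u \<in> V" "v \<in> V" "u \<noteq> v"
  using assms unfolding simple_graph_def nsets_def by (auto simp: card_2_iff)

lemma arc_in_orientation:
  assumes G: "simple_graph V E" and D: "D \<in> orientations V E" and a: "(u, v) \<in> parcs D"
  shows "{u, v} \<in> E" "(v, u) \<notin> parcs D" "u \<in> V" "v \<in> V" "u \<noteq> v"
proof -
  show e: "{u, v} \<in> E" using D a by (simp add: orientations_def)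
  show "(v, u) \<notin> parcs D" using D a e by (simp add: orientations_def)
  show "u \<in> V" "v \<in> V" "u \<noteq> v" using edge_in_vertices[OF G e] by auto
qed

lemma finite_orientations:
  assumes "simple_graph V E"
  shows "finite (orientations V E)"
proof (rule finite_imageD)
  have "parcs ` orientations V E \<subseteq> Pow (V \<times> V)"
    using arc_in_orientation(3,4)[OF assms] by auto
  moreover have "finite V" using assms by (simp add: simple_graph_def)
  ultimately show "finite (parcs ` orientations V E)"
    by (meson finite_Pow_iff finite_SigmaI finite_subset)
  show "inj_on parcs (orientations V E)"
    by (auto simp: inj_on_def orientations_def intro: pair_pre_digraph.equality)
qed

text \<open>Makes \<open>pmf_of_set\<close> on the orientations a genuine uniform distribution.
  Orienting each edge upwards along an injection of \<open>V\<close> into the naturals gives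
  one.\<close>

lemma orientations_nonempty:
  assumes "simple_graph V E"
  shows "orientations V E \<noteq> {}"
proof -
  have "finite V" using assms by (simp add: simple_graph_def)
  then obtain f :: "'a \<Rightarrow> nat" where f: "inj_on f V"
    using finite_imp_inj_to_nat_seg by blast
  have "\<lparr>pverts = V, parcs = {(u, v). {u, v} \<in> E \<and> f u < f v}\<rparr> \<in> orientations V E"
    unfolding orientations_def
  proof (intro CollectI conjI allI impI)
    fix u v assume e: "{u, v} \<in> E"
    then have "f u \<noteq> f v" using edge_in_vertices[OF assms e] f by (auto dest: inj_onD)
    with e show "((u, v) \<in> parcs \<lparr>pverts = V, parcs = {(u, v). {u, v} \<in> E \<and> f u < f v}\<rparr>) \<noteq>
      ((v, u) \<in> parcs \<lparr>pverts = V, parcs = {(u, v). {u, v} \<in> E \<and> f u < f v}\<rparr>)"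
      by (auto simp: insert_commute)
  qed auto
  then show ?thesis by blast
qed

section \<open>The probability that some dense pair has no arc from \<open>U\<close> to
  \<open>W\<close>\<close>

definition reverse_arcs :: "'a set set \<Rightarrow> 'a pair_pre_digraph \<Rightarrow> 'a pair_pre_digraph" where
  "reverse_arcs X D =
     D\<lparr>parcs := {(u, v). if {u, v} \<in> X then (v, u) \<in> parcs D else (u, v) \<in> parcs D}\<rparr>"

lemma arc_reverse_arcs:
  "(u, v) \<in> parcs (reverse_arcs X D) \<longleftrightarrow>
     (if {u, v} \<in> X then (v, u) \<in> parcs D else (u, v) \<in> parcs D)"
  by (simp add: reverse_arcs_def)

lemma reverse_arcs_reverse_arcs [simp]: "reverse_arcs X (reverse_arcs X D) = D"
proof (rule pair_pre_digraph.equality)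
  have "(u, v) \<in> parcs (reverse_arcs X (reverse_arcs X D)) \<longleftrightarrow> (u, v) \<in> parcs D" for u v
    by (simp add: arc_reverse_arcs insert_commute[of v])
  then show "parcs (reverse_arcs X (reverse_arcs X D)) = parcs D" by auto
qed (simp_all add: reverse_arcs_def)

lemma reverse_arcs_orientation:
  assumes "D \<in> orientations V E"
  shows "reverse_arcs X D \<in> orientations V E"
proof -
  have "pverts (reverse_arcs X D) = V"
    using assms by (simp add: orientations_def reverse_arcs_def)
  moreover have "{u, v} \<in> E" if "(u, v) \<in> parcs (reverse_arcs X D)" for u v
  proof -
    have "(u, v) \<in> parcs D \<or> (v, u) \<in> parcs D"
      using that by (auto simp: arc_reverse_arcs split: if_splits)
    then have "{u, v} \<in> E \<or> {v, u} \<in> E" using assms by (auto simp: orientations_def)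
    then show ?thesis by (simp add: insert_commute)
  qed
  moreover have "((u, v) \<in> parcs (reverse_arcs X D)) \<noteq> ((v, u) \<in> parcs (reverse_arcs X D))"
    if "{u, v} \<in> E" for u v
  proof -
    have "((u, v) \<in> parcs D) \<noteq> ((v, u) \<in> parcs D)"
      using that assms unfolding orientations_def by blast
    then show ?thesis by (simp add: arc_reverse_arcs insert_commute)
  qed
  ultimately show ?thesis by (simp add: orientations_def)
qed

text \<open>In counting form: under a uniform orientation the edges between \<open>U\<close> and
  \<open>W\<close> all avoid the direction from \<open>U\<close> to \<open>W\<close> with
  probability at most \<open>2 ^ -e\<close>, where \<open>e\<close> is their number.\<close>

lemma card_orientations_without_arcs:
  assumes G: "simple_graph V E"
  shows "card {D \<in> orientations V E. parcs D \<inter> U \<times> W = {}} * 2 ^ edges_between E U W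
    \<le> card (orientations V E)"
proof -
  define B where "B = {D \<in> orientations V E. parcs D \<inter> U \<times> W = {}}"
  define F where "F = {e \<in> E. \<exists>u\<in>U. \<exists>w\<in>W. e = {u, w}}"
  \<comment> \<open>An edge \<open>{u, w}\<close> of a \<open>D\<close> in \<open>B\<close> is
    directed from \<open>w\<close> to \<open>u\<close>, so the opposite arc appears exactly when the
    edge is reversed.\<close>
  have rec: "e \<in> X \<longleftrightarrow> (u, w) \<in> parcs (reverse_arcs X D)"
    if "D \<in> B" "e = {u, w}" "e \<in> E" "u \<in> U" "w \<in> W" for D e u w X
  proof -
    have "(u, w) \<notin> parcs D" using that by (auto simp: B_def)
    moreover have "((u, w) \<in> parcs D) \<noteq> ((w, u) \<in> parcs D)"
      using that(1-3) unfolding B_def orientations_def by blast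
    ultimately show ?thesis using that(2) by (simp add: arc_reverse_arcs)
  qed
  \<comment> \<open>Reversing a set \<open>X\<close> of edges of \<open>F\<close> in \<open>D \<in> B\<close> is injective in \<open>(D, X)\<close>: the edges now pointing
    from \<open>U\<close> to \<open>W\<close> are exactly those of \<open>X\<close>.\<close>
  have "inj_on (\<lambda>(D, X). reverse_arcs X D) (B \<times> Pow F)"
  proof (rule inj_onI, clarify)
    fix D X D' X'
    assume D: "D \<in> B" "D' \<in> B" and X: "X \<subseteq> F" "X' \<subseteq> F"
      and eq: "reverse_arcs X D = reverse_arcs X' D'"
    have "e \<in> X \<longleftrightarrow> e \<in> X'" if "e \<in> F" for e
    proof -
      obtain u w where e: "e = {u, w}" "e \<in> E" "u \<in> U" "w \<in> W"
        using \<open>e \<in> F\<close> unfolding F_def by blast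
      show ?thesis using rec[OF D(1) e, of X] rec[OF D(2) e, of X'] eq by simp
    qed
    then have "X = X'" using X by blast
    then show "D = D' \<and> X = X'" using eq reverse_arcs_reverse_arcs by metis
  qed
  moreover have "(\<lambda>(D, X). reverse_arcs X D) ` (B \<times> Pow F) \<subseteq> orientations V E"
    by (auto simp: B_def intro: reverse_arcs_orientation)
  ultimately have "card (B \<times> Pow F) \<le> card (orientations V E)"
    using card_inj_on_le finite_orientations[OF G] by blast
  moreover have "finite F" using finite_graph_edges[OF G] by (simp add: F_def)
  ultimately show ?thesis
    by (simp add: card_cartesian_product card_Pow B_def F_def edges_between_def)
qed

lemma prob_dense_pair_without_arcs:
  assumes G: "simple_graph V E"
  shows "measure_pmf.prob (random_orientation V E)
    {D. \<exists>U W. U \<subseteq> V \<and> W \<subseteq> V \<and> 3 * card V \<le> edges_between E U W \<and> parcs D \<inter> U \<times> W = {}}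
    \<le> (1 / 2) ^ card V"
    (is "measure_pmf.prob _ ?X \<le> _")
proof -
  define n where "n = card V"
  define O' where "O' = orientations V E"
  have fin: "finite V" using G by (simp add: simple_graph_def)
  have O: "finite O'" "O' \<noteq> {}"
    using finite_orientations[OF G] orientations_nonempty[OF G] by (auto simp: O'_def)
  define P where "P = {(U, W). U \<subseteq> V \<and> W \<subseteq> V \<and> 3 * n \<le> edges_between E U W}"
  have P: "P \<subseteq> Pow V \<times> Pow V" by (auto simp: P_def)
  have finP: "finite P" using P fin by (meson finite_Pow_iff finite_SigmaI finite_subset)
  have "card P \<le> card (Pow V \<times> Pow V)" using P fin by (intro card_mono) auto
  also have "\<dots> = 4 ^ n"
    using fin by (simp add: card_cartesian_product card_Pow n_def flip: power_mult_distrib)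
  finally have cardP: "card P \<le> 4 ^ n" .
  define B where "B = (\<lambda>(U, W). {D \<in> O'. parcs D \<inter> U \<times> W = {}})"
  \<comment> \<open>The threshold \<open>3 * n\<close> gives \<open>2 ^ (3 * n) = 8 ^ n\<close>,
    which beats the at most \<open>4 ^ n\<close> pairs.\<close>
  have cardB: "real (card (B x)) \<le> real (card O') / 8 ^ n" if "x \<in> P" for x
  proof -
    obtain U W where x: "x = (U, W)" by (cases x)
    have "card (B x) * 8 ^ n = card (B x) * 2 ^ (3 * n)" by (simp add: power_mult)
    also have "\<dots> \<le> card (B x) * 2 ^ edges_between E U W"
      using that by (intro mult_left_mono power_increasing) (auto simp: P_def x)
    also have "\<dots> \<le> card O'"
      using card_orientations_without_arcs[OF G, of U W] by (simp add: B_def x O'_def)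
    finally have "real (card (B x) * 8 ^ n) \<le> real (card O')" by (rule of_nat_mono)
    then show ?thesis by (simp add: field_simps)
  qed
  have "O' \<inter> ?X = (\<Union>x\<in>P. B x)" by (auto simp: P_def B_def n_def)
  then have "real (card (O' \<inter> ?X)) \<le> real (\<Sum>x\<in>P. card (B x))"
    using card_UN_le[OF finP, of B] by (metis of_nat_mono)
  also have "\<dots> \<le> (\<Sum>x\<in>P. real (card O') / 8 ^ n)"
    unfolding of_nat_sum by (intro sum_mono cardB)
  also have "\<dots> = real (card P) * (real (card O') / 8 ^ n)" by simp
  also have "\<dots> \<le> 4 ^ n * (real (card O') / 8 ^ n)"
  proof (rule mult_right_mono)
    have "real (card P) \<le> real (4 ^ n)" using cardP by (rule of_nat_mono)
    then show "real (card P) \<le> 4 ^ n" by simp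
  qed simp
  also have "\<dots> = (4 / 8) ^ n * real (card O')" by (simp only: power_divide) simp
  finally have "real (card (O' \<inter> ?X)) \<le> (1 / 2) ^ n * real (card O')" by simp
  moreover have "card O' > 0" using O by (simp add: card_gt_0_iff)
  ultimately show ?thesis
    unfolding random_orientation_def O'_def[symmetric] n_def[symmetric]
    using O by (simp add: measure_pmf_of_set divide_simps)
qed

section \<open>Counting arcs, and cuts with half of the edges\<close>

text \<open>Forgetting directions maps arcs injectively to edges, because no edge carries both
  arcs.\<close>

lemma sum_outdegree_le:
  assumes G: "simple_graph V E" and D: "D \<in> orientations V E"
  shows "(\<Sum>u\<in>V. card (parcs D `` {u})) \<le> card E"
proof -
  have fin: "finite V" using G by (simp add: simple_graph_def)
  note arc = arc_in_orientation[OF G D]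
  have "finite (parcs D `` {u})" for u
    by (rule finite_subset[OF _ fin]) (use arc(4) in blast)
  then have "(\<Sum>u\<in>V. card (parcs D `` {u})) = card (SIGMA u:V. parcs D `` {u})"
    using fin by (simp add: card_SigmaI)
  also have "\<dots> \<le> card E"
  proof (rule card_inj_on_le)
    show "inj_on (\<lambda>(u, v). {u, v}) (SIGMA u:V. parcs D `` {u})"
      using arc(2) by (auto simp: inj_on_def doubleton_eq_iff)
    show "(\<lambda>(u, v). {u, v}) ` (SIGMA u:V. parcs D `` {u}) \<subseteq> E" using arc(1) by auto
  qed (rule finite_graph_edges[OF G])
  finally show ?thesis .
qed

text \<open>Averaging over all subsets of \<open>V\<close>: each edge crosses exactly half of the
  cuts, so some cut has at least the mean number of edges.\<close>

lemma ex_large_cut: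
  assumes G: "simple_graph V E"
  obtains U where "U \<subseteq> V" "card E \<le> 2 * edges_between E U (V - U)"
proof -
  have fin: "finite V" "finite E" using G finite_graph_edges[OF G] by (auto simp: simple_graph_def)
  define cut where "cut U e \<longleftrightarrow> (\<exists>u\<in>U. \<exists>w\<in>V - U. e = {u, w})" for U e
  have half: "2 * card {U \<in> Pow V. cut U e} = card (Pow V)" if edge: "e \<in> E" for e
  proof -
    obtain a b where e: "e = {a, b}" and ab: "a \<in> V" "b \<in> V" "a \<noteq> b"
      using edge_doubleton[OF G edge] by blast
    have cut: "cut U e \<longleftrightarrow> (a \<in> U \<longleftrightarrow> b \<notin> U)" if "U \<subseteq> V" for U
      using that ab by (auto simp: cut_def e doubleton_eq_iff)
    \<comment> \<open>Moving one endpoint across is an involution exchanging the cuts with and without \<open>e\<close>.\<close>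
    define f where "f U = (if a \<in> U then U - {a} else insert a U)" for U
    have ff: "f (f U) = U" for U by (auto simp: f_def)
    have f: "f U \<subseteq> V \<and> (cut (f U) e \<longleftrightarrow> \<not> cut U e)" if "U \<subseteq> V" for U
    proof -
      have "f U \<subseteq> V" using that ab by (auto simp: f_def)
      then show ?thesis using cut[of U] cut[of "f U"] that ab by (auto simp: f_def)
    qed
    have "bij_betw f {U \<in> Pow V. cut U e} {U \<in> Pow V. \<not> cut U e}"
      by (rule bij_betw_byWitness[where f' = f])
        (use f in \<open>auto simp: ff\<close>)
    then have "card {U \<in> Pow V. cut U e} = card {U \<in> Pow V. \<not> cut U e}"
      by (rule bij_betw_same_card)
    moreover have "card (Pow V) = card {U \<in> Pow V. cut U e} + card {U \<in> Pow V. \<not> cut U e}"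
      using fin by (subst card_Un_disjoint[symmetric]) (auto intro: arg_cong[where f = card])
    ultimately show ?thesis by simp
  qed
  have "(\<Sum>U\<in>Pow V. 2 * edges_between E U (V - U)) = 2 * (\<Sum>U\<in>Pow V. card {e \<in> E. cut U e})"
    by (simp add: edges_between_def cut_def sum_distrib_left)
  also have "(\<Sum>U\<in>Pow V. card {e \<in> E. cut U e}) = (\<Sum>e\<in>E. card {U \<in> Pow V. cut U e})"
    using fin by (intro sum_multicount_gen) auto
  also have "2 * \<dots> = (\<Sum>U\<in>Pow V. card E)"
    using half by (simp add: sum_distrib_left)
  finally have "(\<Sum>U\<in>Pow V. card E) \<le> (\<Sum>U\<in>Pow V. 2 * edges_between E U (V - U))" by simp
  then obtain U where "U \<in> Pow V" "card E \<le> 2 * edges_between E U (V - U)"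
    using sum_strict_mono[of "Pow V" "\<lambda>U. 2 * edges_between E U (V - U)" "\<lambda>U. card E"] fin(1)
    by (metis Pow_not_empty finite_Pow_iff not_le)
  then show ?thesis using that by blast
qed

section \<open>Seymour vertices in terms of arcs\<close>

text \<open>Replaces shortest paths by images under the arc relation. Two inclusions suffice: the
  first neighbourhood lies in \<open>S\<close>, and \<open>T\<close> lies in the second.\<close>

lemma no_seymour_vertexD:
  assumes G: "simple_graph V E" and D: "D \<in> orientations V E"
    and u: "u \<in> V" "\<not> seymour_vertex D u"
  defines "S \<equiv> parcs D `` {u}"
  defines "T \<equiv> parcs D `` S - insert u S"
  shows "card T < card S"
proof -
  have fin: "finite V" using G by (simp add: simple_graph_def)
  have pv: "pverts D = V" using D by (simp add: orientations_def)
  note arc = arc_in_orientation(3-5)[OF G D]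
  note ap = pre_digraph.apath_def pre_digraph.awalk_def cas_with_proj_eq awalk_verts_with_proj_eq
  have "nbhd D 1 u \<subseteq> S"
  proof
    fix v assume "v \<in> nbhd D 1 u"
    then obtain P where P: "pre_digraph.apath (with_proj D) u P v" "length P = 1"
      by (auto simp: nbhd_def)
    then obtain e where "P = [e]" by (auto simp: length_Suc_conv)
    with P show "v \<in> S" by (auto simp: ap S_def)
  qed
  moreover have "finite S" by (rule finite_subset[OF _ fin]) (use arc(2) in \<open>auto simp: S_def\<close>)
  ultimately have 1: "card (nbhd D 1 u) \<le> card S" by (rule card_mono[rotated])
  have "T \<subseteq> nbhd D 2 u"
  proof
    fix v assume "v \<in> T"
    then obtain x where x: "(u, x) \<in> parcs D" "(x, v) \<in> parcs D" and v: "v \<noteq> u" "(u, v) \<notin> parcs D"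
      by (auto simp: T_def S_def)
    have "pre_digraph.apath (with_proj D) u [(u, x), (x, v)] v"
      using x v arc[OF x(1)] arc[OF x(2)] pv by (auto simp: ap)
    \<comment> \<open>The empty path would force \<open>v = u\<close>, and a single arc would put
      \<open>v\<close> into \<open>S\<close>.\<close>
    moreover have "2 \<le> length Q" if Q: "pre_digraph.apath (with_proj D) u Q v" for Q
    proof (rule ccontr)
      assume "\<not> 2 \<le> length Q"
      then consider "Q = []" | e where "Q = [e]" by (cases Q; cases "tl Q") auto
      then show False using Q v by cases (auto simp: ap)
    qed
    ultimately show "v \<in> nbhd D 2 u"
      unfolding nbhd_def by (intro CollectI exI[of _ "[(u, x), (x, v)]"]) (simp add: numeral_2_eq_2)
  qed
  \<comment> \<open>Finiteness matters because an infinite set has \<open>card\<close> equal to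
    0.\<close>
  moreover have "finite (nbhd D 2 u)"
  proof (rule finite_subset)
    show "nbhd D 2 u \<subseteq> V"
    proof
      fix v assume "v \<in> nbhd D 2 u"
      then obtain P where P: "pre_digraph.apath (with_proj D) u P v" "length P = 2"
        by (auto simp: nbhd_def)
      then obtain e f where "P = [e, f]" by (auto simp: length_Suc_conv numeral_2_eq_2)
      with P have "(fst f, v) \<in> parcs D" by (cases f) (auto simp: ap)
      then show "v \<in> V" by (rule arc(2))
    qed
  qed (rule fin)
  ultimately have 2: "card T \<le> card (nbhd D 2 u)" by (rule card_mono[rotated])
  show ?thesis using u 1 2 pv by (simp add: seymour_vertex_def)
qed

section \<open>Edge counts from bijumbledness\<close>

lemma edges_between_commute: "edges_between E U W = edges_between E W U"
  unfolding edges_between_def by (rule arg_cong[where f = card]) (auto simp: insert_commute)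

lemma edges_between_le:
  assumes "finite U" "finite W"
  shows "edges_between E U W \<le> card U * card W"
proof -
  have "edges_between E U W \<le> card ((\<lambda>(u, w). {u, w}) ` (U \<times> W))"
    unfolding edges_between_def using assms by (intro card_mono) auto
  also have "\<dots> \<le> card (U \<times> W)" using assms by (intro card_image_le) auto
  finally show ?thesis by (simp add: card_cartesian_product)
qed

text \<open>In the constant, \<open>4 * A\<^sup>2\<close> keeps the error below half of the main
  term \<open>p |U| |W|\<close>, and \<open>6\<close> makes the remaining half at least
  \<open>3 n\<close>. The conditions on \<open>p * a\<close> and \<open>p * b\<close> supply the
  balance required in \<open>weakly_bijumbled\<close>, whichever set is smaller.\<close>

lemma bijumbled_edges_between_ge:
  fixes a b p A :: real
  assumes fin: "finite V" and jum: "weakly_bijumbled V E p (A * sqrt (real (card V) * p))"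
    and "0 < p"
    and UW: "U \<subseteq> V" "W \<subseteq> V" "U \<inter> W = {}" "a \<le> card U" "b \<le> card W"
    and ab: "1 \<le> p * a" "1 \<le> p * b" "(6 + 4 * A\<^sup>2) * card V \<le> p * a * b"
  shows "3 * card V \<le> edges_between E U W"
  using UW ab
proof (induction "card U" "card W" arbitrary: U W a b rule: linorder_wlog)
  case sym
  have "3 * card V \<le> edges_between E W U"
    by (rule sym(1)[of W U b a]) (use sym(2-) in \<open>auto simp: ac_simps\<close>)
  then show ?case by (simp add: edges_between_commute)
next
  case le
  define n where "n = real (card V)"
  define x where "x = real (card U)"
  define y where "y = real (card W)"
  have pos: "0 < a" "0 < b"
    using le(7,8) zero_less_mult_pos[OF _ \<open>0 < p\<close>, of a] zero_less_mult_pos[OF _ \<open>0 < p\<close>, of b]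
    by linarith+
  have xy: "a \<le> x" "b \<le> y" "x \<le> y" using le by (auto simp: x_def y_def)
  \<comment> \<open>The chain \<open>|W| \<le> n \<le> n p |U|\<close> uses
    \<open>p |U| \<ge> p a \<ge> 1\<close>.\<close>
  have "y \<le> n" using le fin by (auto simp: y_def n_def intro!: card_mono)
  also have "n * 1 \<le> n * (p * x)"
    using le(7) xy \<open>0 < p\<close>
    by (intro mult_left_mono order.trans[OF le(7)]) (auto simp: n_def)
  finally have bal: "y \<le> n * p * x" by (simp add: mult.assoc)
  have "p * a * b \<le> p * x * y"
    using xy pos \<open>0 < p\<close> by (intro mult_mono) auto
  with le(9) have big: "(6 + 4 * A\<^sup>2) * n \<le> p * x * y" by (simp add: n_def)
  have "card U \<noteq> 0" using pos xy by (auto simp: x_def)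
  then have "\<bar>real (edges_between E U W) - p * x * y\<bar> \<le> A * sqrt (n * p) * sqrt (x * y)"
    using jum le bal unfolding weakly_bijumbled_def n_def x_def y_def by auto
  also have "\<dots> \<le> p * x * y / 2"
  proof -
    \<comment> \<open>The square of the error is compared with the square of half the main
      term.\<close>
    have "A\<^sup>2 * (n * p) * (x * y) = (A\<^sup>2 * n) * (p * x * y)" by (simp add: ac_simps)
    also have "\<dots> \<le> (p * x * y / 4) * (p * x * y)"
      using big pos xy \<open>0 < p\<close> by (intro mult_right_mono) (auto simp: n_def algebra_simps)
    also have "\<dots> = (p * x * y / 2)\<^sup>2" by (simp add: power2_eq_square)
    finally have "sqrt (A\<^sup>2 * (n * p) * (x * y)) \<le> p * x * y / 2"
      using pos xy \<open>0 < p\<close> by (intro real_le_lsqrt) auto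
    moreover have "A * sqrt (n * p) * sqrt (x * y) \<le> sqrt (A\<^sup>2 * (n * p) * (x * y))"
      by (simp add: real_sqrt_mult mult_right_mono n_def x_def y_def \<open>0 < p\<close> less_imp_le)
    ultimately show ?thesis by linarith
  qed
  finally have "p * x * y / 2 \<le> real (edges_between E U W)" by linarith
  moreover have "6 * n \<le> p * x * y"
  proof -
    have "6 * n \<le> (6 + 4 * A\<^sup>2) * n" by (intro mult_right_mono) (auto simp: n_def)
    then show ?thesis using big by linarith
  qed
  ultimately have "3 * n \<le> real (edges_between E U W)" by linarith
  then show ?case unfolding n_def by linarith
qed

text \<open>
  Jumbledness bounds only the edges across a cut, so it is applied to a cut containing half of all edges.
  If that cut is too unbalanced for the hypothesis \<open>|W| \<le> n p |U|\<close>, then \<open>|U| < 1/p\<close> and the trivial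
  bound \<open>|U| |W|\<close> is already small enough.
\<close>

lemma bijumbled_card_edges_le:
  fixes p A :: real
  assumes G: "simple_graph V E" and jum: "weakly_bijumbled V E p (A * sqrt (real (card V) * p))"
    and "0 < p" "0 < A" and np: "4 \<le> real (card V) * p\<^sup>2"
  shows "2 * card E \<le> p * (real (card V))\<^sup>2 + 2 * A * card V * sqrt (real (card V) * p)"
proof -
  have fin: "finite V" using G by (simp add: simple_graph_def)
  define n where "n = real (card V)"
  define \<alpha> where "\<alpha> = A * sqrt (n * p)"
  have \<alpha>: "0 \<le> \<alpha>" using \<open>0 < A\<close> \<open>0 < p\<close> by (simp add: \<alpha>_def n_def)
  obtain U0 where U0: "U0 \<subseteq> V" "card E \<le> 2 * edges_between E U0 (V - U0)"
    using ex_large_cut[OF G] .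
  obtain U where U: "U \<subseteq> V" "card E \<le> 2 * edges_between E U (V - U)" "card U \<le> card (V - U)"
  proof (cases "card U0 \<le> card (V - U0)")
    case False
    have "V - (V - U0) = U0" using U0(1) by blast
    then show ?thesis using that[of "V - U0"] U0 False by (simp add: edges_between_commute)
  qed (use U0 that in blast)
  define x where "x = real (card U)"
  define y where "y = real (card (V - U))"
  define e where "e = real (edges_between E U (V - U))"
  have "card U + card (V - U) = card V"
    using U(1) fin by (simp add: card_Diff_subset card_mono finite_subset)
  then have n: "x + y = n" unfolding x_def y_def n_def by (metis of_nat_add)
  have pos: "0 \<le> x" "0 \<le> y" "x \<le> y" using U by (auto simp: x_def y_def)
  have "4 * (x * y) = n\<^sup>2 - (x - y)\<^sup>2" unfolding n[symmetric] by (simp add: power2_eq_square algebra_simps)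
  then have xy: "x * y \<le> n\<^sup>2 / 4" using zero_le_power2[of "x - y"] by linarith
  consider "card U = 0" | "1 \<le> card U" "y \<le> n * p * x" | "n * p * x < y" by linarith
  then have "e \<le> p * n\<^sup>2 / 4 + \<alpha> * n / 2"
  proof cases
    case 1
    then have "U = {}" using finite_subset[OF U(1) fin] by simp
    then have "e = 0" by (simp add: e_def edges_between_def)
    then show ?thesis using \<alpha> \<open>0 < p\<close> by (simp add: n_def)
  next
    case 2
    then have "\<bar>e - p * x * y\<bar> \<le> \<alpha> * sqrt (x * y)"
      using jum U unfolding weakly_bijumbled_def n_def x_def y_def e_def \<alpha>_def by auto
    moreover have "p * (x * y) \<le> p * (n\<^sup>2 / 4)" using xy \<open>0 < p\<close> by (intro mult_left_mono) auto
    moreover have "\<alpha> * sqrt (x * y) \<le> \<alpha> * (n / 2)"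
      using xy \<alpha> by (intro mult_left_mono real_le_lsqrt) (auto simp: n_def power_divide)
    ultimately show ?thesis by (simp add: abs_le_iff mult.assoc)
  next
    case 3
    have "e \<le> x * y"
    proof -
      have "edges_between E U (V - U) \<le> card U * card (V - U)"
        using U(1) fin by (intro edges_between_le) (auto intro: finite_subset)
      then show ?thesis unfolding e_def x_def y_def by (metis of_nat_le_iff of_nat_mult)
    qed
    moreover have "p * (x * y) \<le> n"
    proof -
      have "n * p * x < n" using 3 n pos by linarith
      then have "n * (p * x) < n * 1" by (simp add: mult.assoc)
      then have "p * x < 1" using pos n by (simp only: mult_less_cancel_left)
      then have "(p * x) * y \<le> 1 * y" using pos by (intro mult_right_mono) auto
      then show ?thesis using n pos by (simp add: mult.assoc)
    qed
    \<comment> \<open>Here \<open>4 \<le> n p\<^sup>2\<close> enters: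
      \<open>x y \<le> n / p \<le> p n\<^sup>2 / 4\<close>, with every term multiplied by
      \<open>p\<close>.\<close>
    moreover have "n \<le> p * (p * n\<^sup>2 / 4)"
    proof -
      have "n * 4 \<le> n * (n * p\<^sup>2)" using np by (intro mult_left_mono) (auto simp: n_def)
      then show ?thesis by (simp add: power2_eq_square ac_simps)
    qed
    ultimately have "p * e \<le> p * (p * n\<^sup>2 / 4)"
      using \<open>0 < p\<close> by (meson mult_left_mono order.trans less_imp_le)
    then have "e \<le> p * n\<^sup>2 / 4" using \<open>0 < p\<close> by simp
    then show ?thesis using \<alpha> by (simp add: n_def add_increasing2)
  qed
  moreover have "real (card E) \<le> 2 * e" using U(2) unfolding e_def by linarith
  ultimately have "2 * real (card E) \<le> p * n\<^sup>2 + 2 * (\<alpha> * n)" by (simp add: field_simps)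
  then show ?thesis by (simp add: \<alpha>_def n_def ac_simps)
qed

section \<open>The deterministic argument\<close>

text \<open>Here \<open>s\<close> stands for \<open>sqrt \<epsilon>\<close>, and \<open>good\<close>
  is what the union bound supplies. The value of \<open>c\<close> makes \<open>c / 4\<close> the
  constant \<open>6 + 4 * A\<^sup>2\<close> of the edge count above.\<close>

lemma ex_seymour_vertex:
  fixes A p s c :: real
  assumes G: "simple_graph V E" and D: "D \<in> orientations V E"
    and jum: "weakly_bijumbled V E p (A * sqrt (real (card V) * p))"
    and good: "\<And>U W. \<lbrakk>U \<subseteq> V; W \<subseteq> V; 3 * card V \<le> edges_between E U W\<rbrakk> \<Longrightarrow> parcs D \<inter> U \<times> W \<noteq> {}"
    and pos: "0 < A" "0 < p" "0 < s" and ps: "p < 1 - 15 * s"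
    and c: "c = 24 + 16 * A\<^sup>2" "c\<^sup>2 \<le> real (card V) * p\<^sup>2 * s\<^sup>2"
  shows "\<exists>u. seymour_vertex D u"
proof (rule ccontr)
  assume "\<nexists>u. seymour_vertex D u"
  then have no: "\<not> seymour_vertex D u" for u by blast
  define n where "n = real (card V)"
  define N where "N u = parcs D `` {u}" for u
  have fin: "finite V" using G by (simp add: simple_graph_def)
  have N: "N u \<subseteq> V - {u}" for u
    using arc_in_orientation[OF G D] by (auto simp: N_def)
  have finN: "finite (N u)" for u by (rule finite_subset[OF _ fin]) (use N in blast)
  \<comment> \<open>The form in which jumbledness is applied: if no arc leads from a large
    \<open>U\<close> to a disjoint \<open>W\<close>, then \<open>W\<close> is small.\<close>
  have key: "real (card W) < b"
    if "U \<subseteq> V" "W \<subseteq> V" "U \<inter> W = {}" "parcs D \<inter> U \<times> W = {}" "a \<le> card U"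
      "1 \<le> p * a" "1 \<le> p * b" "(6 + 4 * A\<^sup>2) * n \<le> p * a * b" for U W and a b :: real
  proof (rule ccontr)
    assume "\<not> real (card W) < b"
    then have "3 * card V \<le> edges_between E U W"
      using that by (intro bijumbled_edges_between_ge[OF fin jum pos(2), of U W a b]) (auto simp: n_def)
    then show False using good[OF that(1,2)] that(4) by blast
  qed

  \<comment> \<open>The following estimates all come from
    \<open>c\<^sup>2 \<le> n p\<^sup>2 s\<^sup>2\<close> by dropping factors \<open>p < 1\<close>
    and \<open>s < 1 / 15\<close>.\<close>
  have c24: "24 \<le> c" using c(1) by simp
  have "c * 1 \<le> c * c" using c24 by (intro mult_left_mono) auto
  then have cc: "c \<le> c\<^sup>2" by (simp add: power2_eq_square)
  have lt: "p < 1" "s < 1 / 15" using ps pos by auto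
  have n0: "0 \<le> n" by (simp add: n_def)
  have n1: "c\<^sup>2 \<le> n * p\<^sup>2 * s\<^sup>2" using c(2) by (simp add: n_def)
  have "n * p\<^sup>2 * s\<^sup>2 \<le> n * p\<^sup>2 * (s / 15)"
  proof (intro mult_left_mono)
    have "s * s \<le> s * (1 / 15)" using lt pos by (intro mult_left_mono) auto
    then show "s\<^sup>2 \<le> s / 15" by (simp add: power2_eq_square)
  qed (simp add: n0)
  then have n2: "15 * c\<^sup>2 \<le> n * p\<^sup>2 * s" using n1 by simp
  have pp: "p\<^sup>2 \<le> p" using lt pos by (simp add: power2_eq_square mult_left_le)
  have "n * s * p\<^sup>2 \<le> n * s * p" using pp pos n0 by (intro mult_left_mono) auto
  then have n3: "15 * c\<^sup>2 \<le> n * s * p" using n2 by (simp add: ac_simps)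
  have "n * s * p \<le> n * s" using lt pos n0 by (intro mult_left_le) auto
  then have n4: "15 * c\<^sup>2 \<le> n * s" using n3 by simp
  have "n * p\<^sup>2 * s \<le> n * p\<^sup>2" using lt pos n0 by (intro mult_left_le) auto
  then have n5: "15 * c\<^sup>2 \<le> n * p\<^sup>2" using n2 by simp
  have "n * s \<le> n * (1 / 15)" using lt n0 by (intro mult_left_mono) auto
  then have n6: "15 * (n * s) \<le> n" by simp
  have n7: "c / p \<le> n * s / 15"
    using n3 cc pos by (simp add: divide_le_eq) 
  have n8: "1 \<le> n * s / 15" using n4 c24 cc by linarith
  have "n * p * s \<le> n * p" using lt pos n0 by (intro mult_left_le) auto
  then have n10: "15 * c\<^sup>2 \<le> n * p" using n3 by (simp add: ac_simps)
  have n9: "0 < n" using n8 n6 by linarith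

  define B where "B = {u \<in> V. card (N u) < n * p / (4 * c)}"
  have B: "real (card B) < c / p + 1"
  proof (rule ccontr)
    assume *: "\<not> ?thesis"
    \<comment> \<open>A set of \<open>m\<close> vertices of \<open>B\<close> has at most
      \<open>(2 c / p) (n p / (4 c)) = n / 2\<close> out-neighbours. With fewer than
      \<open>n / 4\<close> vertices in \<open>W\<close> and \<open>m\<close> small, this cannot
      cover \<open>V\<close>.\<close>
    define m where "m = nat \<lceil>c / p\<rceil>"
    have m: "c / p \<le> real m" "real m \<le> c / p + 1"
      using c24 pos by (auto simp: m_def)
    have "m \<le> card B" using m * by linarith
    then obtain U where U: "U \<subseteq> B" "card U = m" by (metis obtain_subset_with_card_n)
    have UV: "U \<subseteq> V" using U by (auto simp: B_def)
    then have finU: "finite U" using fin finite_subset by blast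
    define W where "W = V - U - (\<Union>u\<in>U. N u)"
    have "real (card W) < n / 4"
    proof (rule key[OF UV])
      show "parcs D \<inter> U \<times> W = {}" by (auto simp: W_def N_def)
      show "c / p \<le> real (card U)" using m U by simp
      show "1 \<le> p * (c / p)" using c24 pos by simp
      show "1 \<le> p * (n / 4)" using n10 cc c24 by (simp add: mult.commute)
      show "(6 + 4 * A\<^sup>2) * n \<le> p * (c / p) * (n / 4)"
      proof -
        have "p * (c / p) = c" using pos by simp
        then show ?thesis by (simp add: c(1) algebra_simps)
      qed
    qed (auto simp: W_def)
    moreover have "real (card (\<Union>u\<in>U. N u)) \<le> n / 2"
    proof -
      have "real (card (\<Union>u\<in>U. N u)) \<le> (\<Sum>u\<in>U. real (card (N u)))"
        using card_UN_le[OF finU, of N] by (metis of_nat_mono of_nat_sum)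
      also have "\<dots> \<le> (\<Sum>u\<in>U. n * p / (4 * c))"
        using U by (intro sum_mono) (auto simp: B_def)
      also have "\<dots> = real m * (n * p / (4 * c))" by (simp add: U)
      also have "\<dots> \<le> (2 * c / p) * (n * p / (4 * c))"
      proof (rule mult_right_mono)
        have "1 \<le> c / p" using c24 lt pos by (simp add: le_divide_eq)
        then show "real m \<le> 2 * c / p" using m by linarith
      qed (use n0 pos c24 in auto)
      also have "\<dots> = n / 2" using pos c24 by (simp add: field_simps)
      finally show ?thesis .
    qed
    moreover have "n \<le> real m + real (card (\<Union>u\<in>U. N u)) + real (card W)"
    proof -
      have "V \<subseteq> U \<union> (\<Union>u\<in>U. N u) \<union> W" by (auto simp: W_def)
      then have "card V \<le> card (U \<union> (\<Union>u\<in>U. N u) \<union> W)"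
        using finU finN fin by (intro card_mono) (auto simp: W_def)
      also have "\<dots> \<le> card U + card (\<Union>u\<in>U. N u) + card W"
        by (meson add_right_mono card_Un_le order_trans)
      finally show ?thesis unfolding n_def U(2) by linarith
    qed
    ultimately show False using m n6 n7 n8 n9 by linarith
  qed

  \<comment> \<open>No arc leads from \<open>N u\<close> to the set \<open>W\<close> of vertices
    outside \<open>u\<close>, \<open>N u\<close> and \<open>T\<close>, so \<open>W\<close> is small;
    the rest has at most \<open>1 + |N u| + |T| < 1 + 2 |N u|\<close> vertices.\<close>
  have large: "n - 1 - s * n \<le> 2 * real (card (N u))" if u: "u \<in> V - B" for u
  proof -
    define T where "T = parcs D `` N u - insert u (N u)"
    have T: "card T < card (N u)"
      using no_seymour_vertexD[OF G D _ no, of u] u by (simp add: T_def N_def)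
    define W where "W = V - insert u (N u) - T"
    have "real (card W) < s * n"
    proof (rule key)
      show "parcs D \<inter> N u \<times> W = {}" by (auto simp: W_def T_def)
      show "n * p / (4 * c) \<le> real (card (N u))" using u by (auto simp: B_def)
      have "4 * c \<le> n * p\<^sup>2" using n5 cc c24 by linarith
      moreover have "p * (n * p / (4 * c)) = n * p\<^sup>2 / (4 * c)" by (simp add: power2_eq_square)
      ultimately show "1 \<le> p * (n * p / (4 * c))" using c24 by (simp only: le_divide_eq_1) simp
      show "1 \<le> p * (s * n)" using n3 cc c24 by (simp add: mult.commute mult.left_commute)
      have "(6 + 4 * A\<^sup>2) * n = n * c\<^sup>2 / (4 * c)"
      proof -
        have "(6 + 4 * A\<^sup>2) * n = (c / 4) * n" using c(1) by simp
        also have "\<dots> = n * c\<^sup>2 / (4 * c)" using c24 by (simp add: power2_eq_square)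
        finally show ?thesis .
      qed
      also have "\<dots> \<le> n * (n * p\<^sup>2 * s) / (4 * c)"
        using n2 n0 c24 zero_le_power2[of c] by (intro divide_right_mono mult_left_mono) linarith+
      also have "\<dots> = p * (n * p / (4 * c)) * (s * n)" by (simp add: power2_eq_square)
      finally show "(6 + 4 * A\<^sup>2) * n \<le> p * (n * p / (4 * c)) * (s * n)" .
    qed (use N in \<open>auto simp: W_def\<close>)
    moreover have "n \<le> 1 + real (card (N u)) + real (card T) + real (card W)"
    proof -
      have finT: "finite T"
      proof (rule finite_subset[OF _ fin])
        show "T \<subseteq> V" using arc_in_orientation(4)[OF G D] by (auto simp: T_def)
      qed
      have "V \<subseteq> insert u (N u) \<union> T \<union> W" by (auto simp: W_def)
      then have "card V \<le> card (insert u (N u) \<union> T \<union> W)"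
        using finT finN fin by (intro card_mono) (auto simp: W_def)
      also have "\<dots> \<le> card (insert u (N u)) + card T + card W"
        by (meson add_right_mono card_Un_le order_trans)
      also have "\<dots> \<le> 1 + card (N u) + card T + card W"
        by (simp add: card_insert_if finN)
      finally show ?thesis unfolding n_def by linarith
    qed
    ultimately show ?thesis using T by linarith
  qed

  \<comment> \<open>Omitting the vertices of \<open>B\<close> from the sum costs at most
    \<open>n\<close> for each of them.\<close>
  have "n * (n - 1 - s * n) - (c / p + 1) * n \<le> (n - real (card B)) * (n - 1 - s * n)"
  proof -
    have "0 \<le> n - 1 - s * n" "n - 1 - s * n \<le> n"
      using n6 n8 by (simp_all add: mult.commute)
    then have "real (card B) * (n - 1 - s * n) \<le> (c / p + 1) * n"
      using B by (intro mult_mono) auto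
    then show ?thesis by (simp add: algebra_simps)
  qed
  also have "\<dots> = (\<Sum>u\<in>V - B. n - 1 - s * n)"
  proof -
    have "card (V - B) = card V - card B" "card B \<le> card V"
      using fin by (auto simp: B_def intro!: card_Diff_subset card_mono)
    then show ?thesis by (simp add: n_def of_nat_diff)
  qed
  also have "\<dots> \<le> (\<Sum>u\<in>V - B. 2 * real (card (N u)))" by (intro sum_mono large)
  also have "\<dots> \<le> (\<Sum>u\<in>V. 2 * real (card (N u)))" using fin by (intro sum_mono2) auto
  also have "\<dots> = 2 * real (\<Sum>u\<in>V. card (N u))" by (simp add: sum_distrib_left)
  also have "\<dots> \<le> 2 * real (card E)"
    using sum_outdegree_le[OF G D] by (simp add: N_def del: of_nat_sum)
  also have "\<dots> \<le> p * n\<^sup>2 + 2 * A * n * sqrt (n * p)"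
  proof -
    have "4 \<le> real (card V) * p\<^sup>2" using n5 cc c24 by (simp add: n_def)
    from bijumbled_card_edges_le[OF G jum pos(2,1) this] show ?thesis by (simp add: n_def)
  qed
  also have "\<dots> = n * (p * n + 2 * (A * sqrt (n * p)))" by (simp add: power2_eq_square algebra_simps)
  finally have "n * (n - 1 - s * n - (c / p + 1)) \<le> n * (p * n + 2 * (A * sqrt (n * p)))"
    by (simp add: algebra_simps)
  then have "n - 1 - s * n - (c / p + 1) \<le> p * n + 2 * (A * sqrt (n * p))" using n9 by simp
  \<comment> \<open>From \<open>A\<^sup>2 \<le> c \<le> c\<^sup>2 \<le> n s\<^sup>2\<close> and
    \<open>p < 1\<close>, the squared error \<open>A\<^sup>2 n p\<close> is at most
    \<open>(s n)\<^sup>2\<close>.\<close>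
  moreover have "A * sqrt (n * p) \<le> s * n"
  proof -
    have "n * p\<^sup>2 * s\<^sup>2 = (n * s\<^sup>2) * p\<^sup>2" by simp
    also have "\<dots> \<le> (n * s\<^sup>2) * 1"
      using pp lt n0 by (intro mult_left_mono) auto
    finally have "A\<^sup>2 \<le> n * s\<^sup>2" using n1 cc c(1) zero_le_power2[of A] by linarith
    then have "A\<^sup>2 * (n * p) \<le> (n * s\<^sup>2) * (n * 1)"
      using lt pos n0 by (intro mult_mono) (auto intro: mult_left_le)
    also have "\<dots> = (s * n)\<^sup>2" by (simp add: power2_eq_square)
    finally have "sqrt (A\<^sup>2 * (n * p)) \<le> s * n"
      using pos n0 by (intro real_le_lsqrt) auto
    then show ?thesis using pos by (simp add: real_sqrt_mult)
  qed
  moreover have "p * n \<le> (1 - 15 * s) * n" using ps n0 by (intro mult_right_mono) auto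
  \<comment> \<open>The left side is at least \<open>n - 6 s n / 5\<close> by \<open>n7\<close> and
    \<open>n8\<close>, the right side at most \<open>n - 13 s n\<close>.\<close>
  ultimately show False using n7 n8 n9 by (simp add: algebra_simps)
qed

section \<open>Choice of the constant and passage to the limit\<close>

theorem theorem5:
  fixes A :: real
  assumes "A > 0"
    and "A \<le> (exp 1)\<^sup>2 * sqrt 6"
    and "\<And>p :: nat \<Rightarrow> real. (\<And>n. 0 < p n \<and> p n \<le> 1) \<Longrightarrow>
      (\<lambda>n. measure_pmf.prob (binomial_random_graph n (p n))
             {E. weakly_bijumbled {1..n} E (p n) (A * sqrt (real n * p n))}) \<longlonglongrightarrow> 1"
  shows "\<exists>C::real. C > 1 \<and>
    (\<forall>(\<epsilon> :: nat \<Rightarrow> real) (p :: nat \<Rightarrow> real) (V :: nat \<Rightarrow> 'a set) (E :: nat \<Rightarrow> 'a set set).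
       (\<forall>n. 0 < \<epsilon> n \<and> \<epsilon> n < 1) \<and>
       (\<forall>n. 0 < p n \<and> p n < 1) \<and>
       (\<forall>\<^sub>F n in sequentially.
          simple_graph (V n) (E n) \<and> card (V n) = n \<and>
          weakly_bijumbled (V n) (E n) (p n) (A * sqrt (real n * p n)) \<and>
          (\<epsilon> n) ^ 3 * real n * (p n)\<^sup>2 \<ge> A\<^sup>2 * C \<and>
          p n < 1 - 15 * sqrt (\<epsilon> n)) \<longrightarrow>
       (\<lambda>n. measure_pmf.prob (random_orientation (V n) (E n))
              {D. \<exists>u. seymour_vertex D u}) \<longlonglongrightarrow> 1)"
proof -
  define c where "c = 24 + 16 * A\<^sup>2"
  \<comment> \<open>Chosen so that \<open>A\<^sup>2 * C = A\<^sup>2 + c\<^sup>2\<close> dominates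
    \<open>c\<^sup>2\<close>, while \<open>C > 1\<close>.\<close>
  define C where "C = 1 + c\<^sup>2 / A\<^sup>2"
  have "c > 0" unfolding c_def using zero_le_power2[of A] by linarith
  then have "C > 1" using \<open>A > 0\<close> by (simp add: C_def)
  have "A\<^sup>2 * C = A\<^sup>2 + c\<^sup>2" using \<open>A > 0\<close> by (simp add: C_def field_simps)
  then have cC: "c\<^sup>2 \<le> A\<^sup>2 * C" by simp
  show ?thesis
  proof (intro exI[of _ C] conjI allI impI \<open>C > 1\<close>; elim conjE)
    fix \<epsilon> p :: "nat \<Rightarrow> real" and V :: "nat \<Rightarrow> 'a set" and E :: "nat \<Rightarrow> 'a set set"
    assume e: "\<forall>n. 0 < \<epsilon> n \<and> \<epsilon> n < 1" and p: "\<forall>n. 0 < p n \<and> p n < 1"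
      and ev: "\<forall>\<^sub>F n in sequentially.
          simple_graph (V n) (E n) \<and> card (V n) = n \<and>
          weakly_bijumbled (V n) (E n) (p n) (A * sqrt (real n * p n)) \<and>
          (\<epsilon> n) ^ 3 * real n * (p n)\<^sup>2 \<ge> A\<^sup>2 * C \<and>
          p n < 1 - 15 * sqrt (\<epsilon> n)"
    let ?P = "\<lambda>n. measure_pmf.prob (random_orientation (V n) (E n)) {D. \<exists>u. seymour_vertex D u}"
    have "\<forall>\<^sub>F n in sequentially. 1 - (1 / 2) ^ n \<le> ?P n"
      using ev
    proof eventually_elim
      case (elim n)
      then have G: "simple_graph (V n) (E n)" and n: "card (V n) = n" by auto
      define X where "X = {D :: 'a pair_pre_digraph. \<exists>U W. U \<subseteq> V n \<and> W \<subseteq> V n \<and>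
        3 * card (V n) \<le> edges_between (E n) U W \<and> parcs D \<inter> U \<times> W = {}}"
      \<comment> \<open>Since \<open>\<epsilon> n < 1\<close>, the cube is at most
        \<open>\<epsilon> n\<close>, which is the square of
        \<open>s = sqrt (\<epsilon> n)\<close>.\<close>
      have "\<epsilon> n ^ 3 * (real n * (p n)\<^sup>2) \<le> \<epsilon> n ^ 1 * (real n * (p n)\<^sup>2)"
        using e by (intro mult_right_mono power_decreasing) (auto simp: less_imp_le)
      then have "c\<^sup>2 \<le> real n * (p n)\<^sup>2 * (sqrt (\<epsilon> n))\<^sup>2"
        using elim cC e by (auto simp: less_imp_le ac_simps)
      then have c2: "c\<^sup>2 \<le> real (card (V n)) * (p n)\<^sup>2 * (sqrt (\<epsilon> n))\<^sup>2" by (simp only: n)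
      have jum: "weakly_bijumbled (V n) (E n) (p n) (A * sqrt (real (card (V n)) * p n))"
        and ps: "p n < 1 - 15 * sqrt (\<epsilon> n)"
        using elim by auto
      have p0: "0 < p n" and s0: "0 < sqrt (\<epsilon> n)" using p e by auto
      have "\<exists>u. seymour_vertex D u" if D: "D \<in> orientations (V n) (E n)" and "D \<notin> X" for D
      proof -
        have "parcs D \<inter> U \<times> W \<noteq> {}"
          if "U \<subseteq> V n" "W \<subseteq> V n" "3 * card (V n) \<le> edges_between (E n) U W" for U W
          using \<open>D \<notin> X\<close> that unfolding X_def by blast
        then show ?thesis
          by (rule ex_seymour_vertex[OF G D jum _ \<open>A > 0\<close> p0 s0 ps c_def c2])
      qed
      \<comment> \<open>The implication is known only for orientations of the graph, hence
        monotonicity almost everywhere on the support.\<close>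
      then have "measure_pmf.prob (random_orientation (V n) (E n)) (- X) \<le> ?P n"
        by (intro measure_pmf.finite_measure_mono_AE)
          (auto simp: AE_measure_pmf_iff random_orientation_def set_pmf_of_set
            finite_orientations[OF G] orientations_nonempty[OF G])
      moreover have "measure_pmf.prob (random_orientation (V n) (E n)) (- X)
        = 1 - measure_pmf.prob (random_orientation (V n) (E n)) X"
        using measure_pmf.prob_compl[of X "random_orientation (V n) (E n)"]
        by (simp add: Compl_eq_Diff_UNIV)
      moreover have "measure_pmf.prob (random_orientation (V n) (E n)) X \<le> (1 / 2) ^ n"
        using prob_dense_pair_without_arcs[OF G] by (simp add: X_def n)
      ultimately show ?case by linarith
    qed
    moreover have "\<forall>\<^sub>F n in sequentially. ?P n \<le> 1" by simp
    moreover have "(\<lambda>n. 1 - (1 / 2) ^ n :: real) \<longlonglongrightarrow> 1 - 0"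
      by (intro tendsto_diff tendsto_const LIMSEQ_realpow_zero) auto
    then have "(\<lambda>n. 1 - (1 / 2) ^ n :: real) \<longlonglongrightarrow> 1" by simp
    ultimately show "?P \<longlonglongrightarrow> 1" using tendsto_const by (rule tendsto_sandwich)
  qed
qed

end
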